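(* Consider the quadratic programming problem of minimizing $\frac12\langle Ax,x\rangle+\langle b,x\rangle+c$ subject to $x\in[u,v]$, and its exact penalty DC form $f=f_1-f_2$ described in the context, with $\inf_{x\in\mathbb{R}^n}f(x)>-\infty$. Let $C$ be a nonempty set containing all stationary points of the problem, and assume that the set of objective function values $$V=\{t\in\mathbb{R}:\ \text{there exists } x\in C \text{ such that } t=f(x)\}$$ is finite. Then, from any starting point $x_0\in\mathbb{R}^n$, the hybrid algorithm described in the context finds a global minimizer of the problem in a finite number of iterations.
   Context: Problem: $A=(a_{ij})\in\mathbb{R}^{n\times n}$ is symmetric, $b,u,v\in\mathbb{R}^n$ with $u_i\le v_i$ for all $i$, $c\in\mathbb{R}$, and $[u,v]=\{x\in\mathbb{R}^n: u_i\le x_i\le v_i,\ i=1,\dots,n\}$. DC form: let $d_i=\max\{\sum_{j=1}^n|a_{ij}|-a_{ii},0\}$, $A_2=\mathrm{diag}(d_1,\dots,d_n)$, $A_1=A+A_2$ (both positive semidefinite). Put $$f_1(x)=\tfrac12\langle A_1x,x\rangle+\langle b,x\rangle+c+\gamma\max\{0,\,u_i-x_i,\,x_i-v_i:\ i=1,\dots,n\},\qquad f_2(x)=\tfrac12\langle A_2x,x\rangle,$$ and $f=f_1-f_2$ on $\mathbb{R}^n$; $f_1,f_2$ are convex. Here $\gamma>0$ is an exact penalty parameter, meaning that the global minimizers of $f$ over $\mathbb{R}^n$ are exactly the global minimizers of the box-constrained problem. It is assumed throughout that $f_*=\inf\{f(x):x\in\mathbb{R}^n\}>-\infty$. For a convex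 $\varphi:\mathbb{R}^n\to\mathbb{R}$ and $\varepsilon\ge0$, $\partial_\varepsilon\varphi(x)=\{\xi\in\mathbb{R}^n:\varphi(y)\ge\varphi(x)+\langle\xi,y-x\rangle-\varepsilon\ \forall y\in\mathbb{R}^n\}$ and $\partial\varphi(x)=\partial_0\varphi(x)$. A point $x$ is stationary if $\partial f_2(x)\subseteq\partial f_1(x)$ (since $f_2$ is differentiable, this is the same as $\partial f_2(x)\cap\partial f_1(x)\neq\emptyset$). Algorithm (hybrid method): 1. Select $x_0\in\mathbb{R}^n$; set $\bar x_0=x_0$, $k=0$. 2. Apply a local search (descent) method starting from $\bar x_k$ to find a local minimizer $x_k$ of $f$, with $f(x_k)\le f(\bar x_k)$. 3. For each $\varepsilon>0$ compute $\partial_\varepsilon f_1(x_k)$ and $\partial_\varepsilon f_2(x_k)$. 4. If $\partial_\varepsilon f_2(x_k)\subseteq\partial_\varepsilon f_1(x_k)$ for all $\varepsilon>0$, stop and return $x_k$. 5. Otherwise find $\varepsilon>0$, $\bar\xi_{1k}\in\partial_\varepsilon f_1(x_k)$ and $\bar\xi_{2k}\in\partial_\varepsilon f_2(x_k)$ such that $$\|\bar\xi_{1k}-\bar\xi_{2k}\|=\max_{\xi_2\in\partial_\varepsilon f_2(x_k)}\ \min_{\xi_1\in\partial_\varepsilon f_1(x_k)}\|\xi_1-\xi_2\|>0,$$ where $\bar\xi_{2k}$ attains the maximum and $\bar\xi_{1k}$ attains the minimum for $\xi_2=\bar\xi_{2k}$. 6. Set $\bar d_k=-(\bar\xi_{1k}-\bar\xi_{2k})$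 and find $\bar\alpha_k>0$ minimizing $f(x_k+\alpha\bar d_k)-f(x_k)$ over $\alpha>0$. 7. Set $\bar x_{k+1}=x_k+\bar\alpha_k\bar d_k$, replace $k$ by $k+1$, and go to step 2. An iteration is one pass through steps 2–7; "finds a global minimizer in a finite number of iterations" means that the algorithm stops in step 4 after finitely many iterations with $x_k$ a global minimizer. *)

theory Defs
  imports "HOL-Analysis.Analysis"
begin

definition eps_subdiff :: "real \<Rightarrow> ('a::real_inner \<Rightarrow> real) \<Rightarrow> 'a \<Rightarrow> 'a set" where
  "eps_subdiff \<epsilon> \<phi> x = {\<xi>. \<forall>y. \<phi> y \<ge> \<phi> x + \<xi> \<bullet> (y - x) - \<epsilon>}"

definition subdiff :: "('a::real_inner \<Rightarrow> real) \<Rightarrow> 'a \<Rightarrow> 'a set" where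
  "subdiff \<phi> x = eps_subdiff 0 \<phi> x"

definition stationary :: "('a::real_inner \<Rightarrow> real) \<Rightarrow> ('a \<Rightarrow> real) \<Rightarrow> 'a \<Rightarrow> bool" where
  "stationary f1 f2 x \<longleftrightarrow> subdiff f2 x \<subseteq> subdiff f1 x"

definition local_minimizer :: "('a::topological_space \<Rightarrow> real) \<Rightarrow> 'a \<Rightarrow> bool" where
  "local_minimizer f x \<longleftrightarrow> (\<forall>\<^sub>F y in nhds x. f x \<le> f y)"

definition global_minimizer_on :: "('a \<Rightarrow> real) \<Rightarrow> 'a set \<Rightarrow> 'a \<Rightarrow> bool" where
  "global_minimizer_on f S x \<longleftrightarrow> is_arg_min f (\<lambda>y. y \<in> S) x"


definition quad_obj :: "real^'n^'n \<Rightarrow> real^'n \<Rightarrow> real \<Rightarrow> real^'n \<Rightarrow> real" where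
  "quad_obj A b c x = 1/2 * ((A *v x) \<bullet> x) + b \<bullet> x + c"

definition box_penalty :: "real^'n \<Rightarrow> real^'n \<Rightarrow> real^'n \<Rightarrow> real" where
  "box_penalty u v x = Max ({0} \<union> range (\<lambda>i. u $ i - x $ i) \<union> range (\<lambda>i. x $ i - v $ i))"

definition diag_shift :: "real^'n^'n \<Rightarrow> real^'n^'n" where
  "diag_shift A =
     (\<chi> i j. if i = j then max ((\<Sum>k\<in>UNIV. \<bar>A $ i $ k\<bar>) - A $ i $ i) 0 else 0)"

definition dc_f1 ::
  "real^'n^'n \<Rightarrow> real^'n \<Rightarrow> real \<Rightarrow> real^'n \<Rightarrow> real^'n \<Rightarrow> real \<Rightarrow> real^'n \<Rightarrow> real" where
  "dc_f1 A b c u v \<gamma> x = quad_obj (A + diag_shift A) b c x + \<gamma> * box_penalty u v x"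

definition dc_f2 :: "real^'n^'n \<Rightarrow> real^'n \<Rightarrow> real" where
  "dc_f2 A x = 1/2 * ((diag_shift A *v x) \<bullet> x)"

definition dc_f ::
  "real^'n^'n \<Rightarrow> real^'n \<Rightarrow> real \<Rightarrow> real^'n \<Rightarrow> real^'n \<Rightarrow> real \<Rightarrow> real^'n \<Rightarrow> real" where
  "dc_f A b c u v \<gamma> x = dc_f1 A b c u v \<gamma> x - dc_f2 A x"

definition exact_penalty_parameter ::
  "real^'n^'n \<Rightarrow> real^'n \<Rightarrow> real \<Rightarrow> real^'n \<Rightarrow> real^'n \<Rightarrow> real \<Rightarrow> bool" where
  "exact_penalty_parameter A b c u v \<gamma> \<longleftrightarrow> \<gamma> > 0 \<and>
     (\<forall>x. global_minimizer_on (dc_f A b c u v \<gamma>) UNIV x \<longleftrightarrow>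
          global_minimizer_on (quad_obj A b c) (cbox u v) x)"


definition global_test :: "('a::real_inner \<Rightarrow> real) \<Rightarrow> ('a \<Rightarrow> real) \<Rightarrow> 'a \<Rightarrow> bool" where
  "global_test f1 f2 x \<longleftrightarrow> (\<forall>\<epsilon>>0. eps_subdiff \<epsilon> f2 x \<subseteq> eps_subdiff \<epsilon> f1 x)"

text \<open>The infimum below is the inner minimum of the max-min problem: for convex finite-valued
  functions on Euclidean space the \<open>\<epsilon>\<close>-subdifferentials are nonempty and compact.\<close>

definition max_min_pair ::
  "('a::real_inner \<Rightarrow> real) \<Rightarrow> ('a \<Rightarrow> real) \<Rightarrow> 'a \<Rightarrow> real \<Rightarrow> 'a \<Rightarrow> 'a \<Rightarrow> bool" where
  "max_min_pair f1 f2 x \<epsilon> \<xi>1 \<xi>2 \<longleftrightarrow>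
     is_arg_max (\<lambda>\<eta>. INF \<xi>\<in>eps_subdiff \<epsilon> f1 x. norm (\<xi> - \<eta>)) (\<lambda>\<eta>. \<eta> \<in> eps_subdiff \<epsilon> f2 x) \<xi>2 \<and>
     is_arg_min (\<lambda>\<xi>. norm (\<xi> - \<xi>2)) (\<lambda>\<xi>. \<xi> \<in> eps_subdiff \<epsilon> f1 x) \<xi>1"

text \<open>The algorithm is a nondeterministic transition system, since the local minimizer, \<open>\<epsilon>\<close>, the
  pair of \<open>\<epsilon>\<close>-subgradients and the step size need not be unique.  The argument of
  \<open>Local_Search\<close> is the starting point \<open>\<bar>x\<^sub>k\<close> of the local search, that of
  \<open>Test\<close> is the local minimizer \<open>x\<^sub>k\<close>, and that of \<open>Returned\<close> is the output.  An iteration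
  consists of two transitions.\<close>

datatype 'a state = Local_Search 'a | Test 'a | Returned 'a

inductive hybrid_step ::
  "('a::real_inner \<Rightarrow> real) \<Rightarrow> ('a \<Rightarrow> real) \<Rightarrow> 'a state \<Rightarrow> 'a state \<Rightarrow> bool"
  for f1 f2 where
  local_search:
    "\<lbrakk>local_minimizer (\<lambda>y. f1 y - f2 y) x; f1 x - f2 x \<le> f1 xb - f2 xb\<rbrakk>
     \<Longrightarrow> hybrid_step f1 f2 (Local_Search xb) (Test x)"
| stop:
    "global_test f1 f2 x \<Longrightarrow> hybrid_step f1 f2 (Test x) (Returned x)"
| descent:
    "\<lbrakk>\<not> global_test f1 f2 x;
      \<epsilon> > 0; max_min_pair f1 f2 x \<epsilon> \<xi>1 \<xi>2; norm (\<xi>1 - \<xi>2) > 0;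
      d = - (\<xi>1 - \<xi>2);
      is_arg_min (\<lambda>a. (f1 (x + a *\<^sub>R d) - f2 (x + a *\<^sub>R d)) - (f1 x - f2 x)) (\<lambda>a. a > 0) \<alpha>\<rbrakk>
     \<Longrightarrow> hybrid_step f1 f2 (Test x) (Local_Search (x + \<alpha> *\<^sub>R d))"

text \<open>Whatever choices are made, the execution is finite, never gets stuck in a step that cannot
  be carried out, and returns a point satisfying \<open>P\<close>.\<close>

definition hybrid_finds ::
  "('a::real_inner \<Rightarrow> real) \<Rightarrow> ('a \<Rightarrow> real) \<Rightarrow> 'a \<Rightarrow> ('a \<Rightarrow> bool) \<Rightarrow> bool" where
  "hybrid_finds f1 f2 x0 P \<longleftrightarrow>
     (\<nexists>\<sigma>. \<sigma> (0::nat) = Local_Search x0 \<and> (\<forall>m. hybrid_step f1 f2 (\<sigma> m) (\<sigma> (Suc m)))) \<and>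
     (\<forall>s. rtranclp (hybrid_step f1 f2) (Local_Search x0) s \<and> (\<nexists>s'. hybrid_step f1 f2 s s')
          \<longrightarrow> (\<exists>x. s = Returned x \<and> P x))"

end

theory Submission
  imports Defs "HOL-Real_Asymp.Real_Asymp"
begin

text \<open>Write \<open>f = f1 - f2\<close> with \<open>f1\<close> and \<open>f2\<close> convex.  Every result of a local search is a local
  minimizer, hence stationary, so its value belongs to a finite set.  If the global test fails at
  such a point, the next step strictly decreases \<open>f\<close>; hence the values at successive local
  minimizers are distinct, and only finitely many iterations are possible.  If the test succeeds,
  the point is a global minimizer of \<open>f\<close>, hence, by exactness of the penalty, of the
  box-constrained problem.

  Decrease and success rest on one fact about a convex function \<open>\<phi>\<close>,
  \<open>eps_subgradient_above_slope\<close>: if a ray starts \<open>\<epsilon>\<close> below the graph of \<open>\<phi>\<close> at \<open>x\<close> and never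
  rises above the graph, then some \<open>\<epsilon>\<close>-subgradient of \<open>\<phi>\<close> at \<open>x\<close> has at least the slope of the
  ray in its direction.
  It makes the residual of a projection onto the \<open>\<epsilon>\<close>-subdifferential of \<open>f1\<close>
  a descent direction (\<open>projection_residual_descends\<close>), and it makes the
  \<open>\<epsilon>\<close>-subdifferentials nonempty, which is what the sufficiency of the global test
  (\<open>global_test_imp_global_minimizer\<close>) needs.

  The method must also never get stuck.  The local search can always return a global minimizer of
  \<open>f\<close>, which exists because the box is compact and the penalty exact.  The max-min
  problem is solvable because \<open>\<epsilon>\<close>-subdifferentials are compact.  The line search is solvable because
  along a ray the box penalty is eventually affine, so \<open>f\<close> is eventually a quadratic polynomial
  and attains its infimum once it is bounded below (\<open>line_search_solvable\<close>); the descent property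
  keeps the minimizing step size away from \<open>0\<close>.\<close>

section \<open>Approximate subgradients of convex functions\<close>

lemma eps_subdiffD: "\<xi> \<in> eps_subdiff \<epsilon> f x \<Longrightarrow> f x + \<xi> \<bullet> (y - x) - \<epsilon> \<le> f y"
  by (auto simp: eps_subdiff_def)

lemma eps_subdiff_eq_INT_halfspaces:
  "eps_subdiff \<epsilon> f x = (\<Inter>y. {\<xi>. (y - x) \<bullet> \<xi> \<le> f y - f x + \<epsilon>})"
  by (auto simp: eps_subdiff_def inner_commute algebra_simps)

lemma closed_eps_subdiff: "closed (eps_subdiff \<epsilon> f x)"
  unfolding eps_subdiff_eq_INT_halfspaces by (auto intro: closed_halfspace_le)

lemma convex_eps_subdiff: "convex (eps_subdiff \<epsilon> f x)"
  unfolding eps_subdiff_eq_INT_halfspaces by (auto intro: convex_INT convex_halfspace_le)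

lemma bounded_eps_subdiff:
  fixes f :: "'a::euclidean_space \<Rightarrow> real"
  assumes cont: "continuous_on UNIV f"
  shows "bounded (eps_subdiff \<epsilon> f x)"
proof -
  have "compact (f ` cball x 1)"
    by (intro compact_continuous_image continuous_on_subset[OF cont]) auto
  then obtain M where M: "\<And>y. y \<in> cball x 1 \<Longrightarrow> \<bar>f y\<bar> \<le> M"
    using compact_imp_bounded bounded_iff by (metis imageI real_norm_def)
  have "norm \<xi> \<le> M - f x + \<epsilon>" if xi: "\<xi> \<in> eps_subdiff \<epsilon> f x" and "\<xi> \<noteq> 0" for \<xi>
  proof -
    let ?y = "x + sgn \<xi>"
    have "\<xi> \<bullet> sgn \<xi> = norm \<xi>"
      using \<open>\<xi> \<noteq> 0\<close> by (simp add: sgn_div_norm power2_norm_eq_inner[symmetric] power2_eq_square)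
    moreover have "f ?y \<le> M"
      using M[of ?y] \<open>\<xi> \<noteq> 0\<close> by (auto simp: dist_norm norm_sgn)
    ultimately show ?thesis
      using eps_subdiffD[OF xi, of ?y] by simp
  qed
  then have "norm \<xi> \<le> max 0 (M - f x + \<epsilon>)" if "\<xi> \<in> eps_subdiff \<epsilon> f x" for \<xi>
    using that by (cases "\<xi> = 0") (auto simp: le_max_iff_disj)
  then show ?thesis
    by (auto simp: bounded_iff)
qed

lemma compact_eps_subdiff:
  fixes f :: "'a::euclidean_space \<Rightarrow> real"
  assumes "continuous_on UNIV f"
  shows "compact (eps_subdiff \<epsilon> f x)"
  using bounded_eps_subdiff[OF assms] closed_eps_subdiff compact_eq_bounded_closed by blast

text \<open>The ray that starts \<open>\<epsilon>\<close> below the graph of \<open>f\<close> at \<open>x\<close> and has slope \<open>s\<close> over the direction \<open>d\<close>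
  avoids the strict epigraph of \<open>f\<close>.  A hyperplane separating these two convex sets cannot be
  vertical, because the ray starts below an interior point of the domain, and its slope
  is the required \<open>\<epsilon>\<close>-subgradient.\<close>

lemma eps_subgradient_above_slope:
  fixes f :: "'a::euclidean_space \<Rightarrow> real"
  assumes conv: "convex_on UNIV f" and "\<epsilon> > 0"
    and ray: "\<And>\<alpha>. \<alpha> > 0 \<Longrightarrow> f x - \<epsilon> + \<alpha> * s \<le> f (x + \<alpha> *\<^sub>R d)"
  obtains \<xi> where "\<xi> \<in> eps_subdiff \<epsilon> f x" "s \<le> \<xi> \<bullet> d"
proof -
  define E where "E = {(y, t). f y < t}"
  define R where "R = (\<lambda>\<alpha>. (x, f x - \<epsilon>) + \<alpha> *\<^sub>R (d, s)) ` {0..}"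
  have "convex E"
    unfolding convex_alt
  proof (intro ballI allI impI)
    fix p q :: "'a \<times> real" and w :: real
    assume "p \<in> E" "q \<in> E" and w: "0 \<le> w \<and> w \<le> 1"
    then have pq: "f (fst p) < snd p" "f (fst q) < snd q"
      by (auto simp: E_def)
    have "f ((1 - w) *\<^sub>R fst p + w *\<^sub>R fst q) \<le> (1 - w) * f (fst p) + w * f (fst q)"
      using convex_onD[OF conv, of w "fst p" "fst q"] w by auto
    also have "\<dots> < (1 - w) * snd p + w * snd q"
    proof (cases "w = 0")
      case False
      with w pq show ?thesis
        by (intro add_le_less_mono mult_left_mono mult_strict_left_mono) auto
    qed (use pq in auto)
    finally show "(1 - w) *\<^sub>R p + w *\<^sub>R q \<in> E"
      by (auto simp: E_def case_prod_beta)
  qed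
  moreover have "convex R"
  proof -
    have "R = (+) (x, f x - \<epsilon>) ` ((\<lambda>\<alpha>. \<alpha> *\<^sub>R (d, s)) ` {0..})"
      by (auto simp: R_def image_image)
    moreover have "convex ((\<lambda>\<alpha>::real. \<alpha> *\<^sub>R (d, s)) ` {0..})"
      by (intro convex_linear_image linearI) (auto simp: algebra_simps)
    ultimately show ?thesis
      by (simp only: convex_translation)
  qed
  moreover have "R \<inter> E = {}"
  proof -
    have "\<not> f (x + \<alpha> *\<^sub>R d) < f x - \<epsilon> + \<alpha> * s" if "\<alpha> \<ge> 0" for \<alpha>
      using ray[of \<alpha>] that \<open>\<epsilon> > 0\<close> by (cases "\<alpha> = 0") auto
    then show ?thesis
      by (auto simp: R_def E_def)
  qed
  moreover have "(x, f x + 1) \<in> E" "(x, f x - \<epsilon>) \<in> R"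
    by (auto simp: E_def R_def image_iff intro!: bexI[of _ 0])
  ultimately obtain z \<beta> where "z \<noteq> 0" and zR: "\<And>r. r \<in> R \<Longrightarrow> z \<bullet> r \<le> \<beta>"
    and zE: "\<And>e. e \<in> E \<Longrightarrow> \<beta> \<le> z \<bullet> e"
    using separating_hyperplane_sets[of R E] by blast
  obtain p q where z: "z = (p, q)"
    by (cases z)
  have sep: "p \<bullet> (x + \<alpha> *\<^sub>R d) + q * (f x - \<epsilon> + \<alpha> * s) \<le> p \<bullet> y + q * t"
    if "\<alpha> \<ge> 0" "f y < t" for \<alpha> y t
  proof -
    have "(x + \<alpha> *\<^sub>R d, f x - \<epsilon> + \<alpha> * s) \<in> R" "(y, t) \<in> E"
      using that by (auto simp: R_def E_def)
    then show ?thesis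
      using zR zE order_trans unfolding z by fastforce
  qed
  have "q * (1 + \<epsilon>) \<ge> 0"
    using sep[of 0 x "f x + 1"] by (simp add: algebra_simps)
  then have "q \<ge> 0"
    using \<open>\<epsilon> > 0\<close> by (simp add: zero_le_mult_iff)
  moreover have "q \<noteq> 0"
  proof
    assume "q = 0"
    then have "p \<bullet> p \<le> 0"
      using sep[of 0 "x - p" "f (x - p) + 1"] by (simp add: inner_diff_right)
    then have "p = 0"
      by (metis inner_gt_zero_iff not_less)
    with \<open>q = 0\<close> \<open>z \<noteq> 0\<close> z show False
      by (simp add: zero_prod_def)
  qed
  ultimately have "q > 0"
    by simp
  define \<xi> where "\<xi> = (- (1 / q)) *\<^sub>R p"
  have p: "p = (- q) *\<^sub>R \<xi>"
    using \<open>q > 0\<close> by (simp add: \<xi>_def)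
  show thesis
  proof
    have "f x + \<xi> \<bullet> (y - x) - \<epsilon> \<le> f y" for y
    proof (rule field_le_epsilon)
      fix e :: real assume "e > 0"
      then have "q * (f x + \<xi> \<bullet> (y - x) - \<epsilon>) \<le> q * (f y + e)"
        using sep[of 0 y "f y + e"] by (simp add: p algebra_simps)
      then show "f x + \<xi> \<bullet> (y - x) - \<epsilon> \<le> f y + e"
        using \<open>q > 0\<close> by simp
    qed
    then show "\<xi> \<in> eps_subdiff \<epsilon> f x"
      by (auto simp: eps_subdiff_def)
    show "s \<le> \<xi> \<bullet> d"
    proof (rule ccontr)
      assume "\<not> s \<le> \<xi> \<bullet> d"
      then have pos: "s - \<xi> \<bullet> d > 0"
        by simp
      \<comment> \<open>Far enough along the ray, the excess slope outweighs the initial gap of \<open>1 + \<epsilon>\<close>.\<close>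
      define \<alpha> where "\<alpha> = (2 + \<epsilon>) / (s - \<xi> \<bullet> d)"
      have "\<alpha> \<ge> 0"
        using pos \<open>\<epsilon> > 0\<close> by (simp add: \<alpha>_def)
      then have "q * (\<alpha> * (s - \<xi> \<bullet> d)) \<le> q * (1 + \<epsilon>)"
        using sep[of \<alpha> x "f x + 1"] by (simp add: p algebra_simps)
      then have "\<alpha> * (s - \<xi> \<bullet> d) \<le> 1 + \<epsilon>"
        using \<open>q > 0\<close> by simp
      then show False
        using pos by (simp add: \<alpha>_def)
    qed
  qed
qed

lemma eps_subdiff_nonempty:
  fixes f :: "'a::euclidean_space \<Rightarrow> real"
  assumes "convex_on UNIV f" and "\<epsilon> > 0"
  shows "eps_subdiff \<epsilon> f x \<noteq> {}"
proof -
  obtain \<xi> where "\<xi> \<in> eps_subdiff \<epsilon> f x"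
    using eps_subgradient_above_slope[of f \<epsilon> x 0 0] assms by auto
  then show ?thesis
    by blast
qed

section \<open>Optimality conditions and descent directions for differences of convex functions\<close>

text \<open>Near a local minimizer of \<open>f1 - f2\<close>, every affine minorant of \<open>f2\<close> touching at the point is,
  after a vertical shift, a local minorant of \<open>f1\<close>; by convexity of \<open>f1\<close> it is a global one.\<close>

lemma local_minimizer_imp_stationary:
  fixes f1 f2 :: "'a::real_inner \<Rightarrow> real"
  assumes conv: "convex_on UNIV f1" and locmin: "local_minimizer (\<lambda>y. f1 y - f2 y) x"
  shows "stationary f1 f2 x"
  unfolding stationary_def subdiff_def
proof
  fix \<xi> assume xi: "\<xi> \<in> eps_subdiff 0 f2 x"
  from locmin obtain r where "r > 0"
    and r: "\<And>y. dist y x < r \<Longrightarrow> f1 x - f2 x \<le> f1 y - f2 y"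
    by (auto simp: local_minimizer_def eventually_nhds_metric)
  have "f1 x + \<xi> \<bullet> (y - x) \<le> f1 y" for y
  proof -
    have pos: "0 < norm (y - x) + 1"
      by (simp add: add_nonneg_pos)
    define t where "t = min 1 (r / (norm (y - x) + 1))"
    have t: "0 < t" "t \<le> 1"
      using \<open>r > 0\<close> pos by (auto simp: t_def)
    have "t * norm (y - x) \<le> r / (norm (y - x) + 1) * norm (y - x)"
      by (intro mult_right_mono) (auto simp: t_def)
    also have "\<dots> < r"
      using \<open>r > 0\<close> pos by (simp add: pos_divide_less_eq)
    finally have "t * norm (y - x) < r" .
    then have near: "f1 x - f2 x \<le> f1 (x + t *\<^sub>R (y - x)) - f2 (x + t *\<^sub>R (y - x))"
      using t by (intro r) (simp add: dist_norm)
    have "f1 ((1 - t) *\<^sub>R x + t *\<^sub>R y) \<le> (1 - t) * f1 x + t * f1 y"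
      using convex_onD[OF conv, of t x y] t by auto
    moreover have "(1 - t) *\<^sub>R x + t *\<^sub>R y = x + t *\<^sub>R (y - x)"
      by (simp add: algebra_simps)
    ultimately have "t * (f1 x + \<xi> \<bullet> (y - x)) \<le> t * f1 y"
      using near eps_subdiffD[OF xi, of "x + t *\<^sub>R (y - x)"] by (simp add: algebra_simps)
    then show ?thesis
      using t by simp
  qed
  then show "\<xi> \<in> eps_subdiff 0 f1 x"
    by (auto simp: eps_subdiff_def)
qed

text \<open>This is the sufficiency part of Hiriart-Urruty's criterion for global optimality.  An almost
  exact subgradient of \<open>f2\<close> at a competitor \<open>y\<close> is an \<open>\<epsilon>\<close>-subgradient of \<open>f2\<close> at \<open>x\<close>, where \<open>\<epsilon>\<close>
  is its linearization error.  As an \<open>\<epsilon>\<close>-subgradient of \<open>f1\<close> at \<open>x\<close>, it bounds \<open>f1 y\<close> from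
  below by just the right amount.\<close>

lemma global_test_imp_global_minimizer:
  fixes f1 f2 :: "'a::euclidean_space \<Rightarrow> real"
  assumes conv: "convex_on UNIV f2" and test: "global_test f1 f2 x"
  shows "f1 x - f2 x \<le> f1 y - f2 y"
proof (rule field_le_epsilon)
  fix e :: real assume "e > 0"
  define \<delta> where "\<delta> = e / 2"
  have "\<delta> > 0"
    using \<open>e > 0\<close> by (simp add: \<delta>_def)
  then obtain \<eta> where eta: "\<eta> \<in> eps_subdiff \<delta> f2 y"
    using eps_subdiff_nonempty[OF conv] by blast
  \<comment> \<open>One \<open>\<delta>\<close> accounts for the inexact subgradient, the other one makes \<open>\<epsilon>\<close> strictly positive.\<close>
  define \<epsilon> where "\<epsilon> = f2 x - f2 y - \<eta> \<bullet> (x - y) + 2 * \<delta>"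
  have "\<epsilon> > 0"
    using eps_subdiffD[OF eta, of x] \<open>\<delta> > 0\<close> by (simp add: \<epsilon>_def)
  have "f2 x + \<eta> \<bullet> (z - x) - \<epsilon> \<le> f2 z" for z
    using eps_subdiffD[OF eta, of z] \<open>\<delta> > 0\<close> by (simp add: \<epsilon>_def inner_diff_right)
  then have "\<eta> \<in> eps_subdiff \<epsilon> f2 x"
    by (auto simp: eps_subdiff_def)
  with test \<open>\<epsilon> > 0\<close> have "\<eta> \<in> eps_subdiff \<epsilon> f1 x"
    by (auto simp: global_test_def)
  from eps_subdiffD[OF this, of y] show "f1 x - f2 x \<le> f1 y - f2 y + e"
    by (simp add: \<epsilon>_def \<delta>_def inner_diff_right)
qed

text \<open>If \<open>f1 - f2\<close> never dropped below its value at \<open>x\<close> along \<open>d = \<xi>2 - \<xi>1\<close>, then \<open>f1\<close> would lie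
  above the ray of slope \<open>\<xi>2 \<bullet> d\<close> starting \<open>\<epsilon>\<close> below its graph, so some \<open>\<epsilon>\<close>-subgradient of \<open>f1\<close>
  would have slope at least \<open>\<xi>2 \<bullet> d\<close> along \<open>d\<close>.  But the projection \<open>\<xi>1\<close> of \<open>\<xi>2\<close> has the largest
  slope along \<open>d\<close> among these, which falls short of \<open>\<xi>2 \<bullet> d\<close> by \<open>norm d ^ 2\<close>.\<close>

lemma projection_residual_descends:
  fixes f1 f2 :: "'a::euclidean_space \<Rightarrow> real"
  assumes conv: "convex_on UNIV f1" and "\<epsilon> > 0"
    and xi2: "\<xi>2 \<in> eps_subdiff \<epsilon> f2 x"
    and proj: "is_arg_min (\<lambda>\<xi>. norm (\<xi> - \<xi>2)) (\<lambda>\<xi>. \<xi> \<in> eps_subdiff \<epsilon> f1 x) \<xi>1"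
    and "norm (\<xi>1 - \<xi>2) > 0" and d: "d = - (\<xi>1 - \<xi>2)"
  obtains \<alpha> where "\<alpha> > 0" "f1 (x + \<alpha> *\<^sub>R d) - f2 (x + \<alpha> *\<^sub>R d) < f1 x - f2 x"
proof -
  have "\<exists>\<alpha>>0. f1 (x + \<alpha> *\<^sub>R d) - f2 (x + \<alpha> *\<^sub>R d) < f1 x - f2 x"
  proof (rule ccontr)
    assume no: "\<not> ?thesis"
    have "f1 x - \<epsilon> + \<alpha> * (\<xi>2 \<bullet> d) \<le> f1 (x + \<alpha> *\<^sub>R d)" if "\<alpha> > 0" for \<alpha>
    proof -
      have "f1 x - f2 x \<le> f1 (x + \<alpha> *\<^sub>R d) - f2 (x + \<alpha> *\<^sub>R d)"
        using no that by force
      then show ?thesis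
        using eps_subdiffD[OF xi2, of "x + \<alpha> *\<^sub>R d"] by simp
    qed
    then obtain \<xi> where xi: "\<xi> \<in> eps_subdiff \<epsilon> f1 x" and slope: "\<xi>2 \<bullet> d \<le> \<xi> \<bullet> d"
      using eps_subgradient_above_slope[OF conv \<open>\<epsilon> > 0\<close>] by blast
    have "\<xi>1 \<in> eps_subdiff \<epsilon> f1 x"
      using proj by (simp add: is_arg_min_def)
    moreover have "\<forall>z\<in>eps_subdiff \<epsilon> f1 x. dist \<xi>2 \<xi>1 \<le> dist \<xi>2 z"
      using proj by (simp add: is_arg_min_linorder dist_norm norm_minus_commute)
    ultimately have "(\<xi>2 - \<xi>1) \<bullet> (\<xi> - \<xi>1) \<le> 0"
      using any_closest_point_dot[OF convex_eps_subdiff closed_eps_subdiff _ xi] by blast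
    with slope have "(\<xi>2 - \<xi>1) \<bullet> (\<xi>2 - \<xi>1) \<le> 0"
      by (simp add: d inner_diff_left inner_diff_right inner_commute)
    then have "\<xi>2 - \<xi>1 = 0"
      by (metis inner_gt_zero_iff not_less)
    then show False
      using \<open>norm (\<xi>1 - \<xi>2) > 0\<close> by simp
  qed
  then show thesis
    using that by blast
qed

text \<open>The distance to the set of \<open>\<epsilon>\<close>-subgradients of \<open>f1\<close> is continuous, hence attains its
  maximum over the compact set of \<open>\<epsilon>\<close>-subgradients of \<open>f2\<close>.  For an \<open>\<epsilon>\<close> at which the test fails,
  the maximum is positive, because the former set is closed.\<close>

lemma failed_test_imp_max_min_pair:
  fixes f1 f2 :: "'a::euclidean_space \<Rightarrow> real"
  assumes conv1: "convex_on UNIV f1" and conv2: "convex_on UNIV f2"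
    and fail: "\<not> global_test f1 f2 x"
  obtains \<epsilon> \<xi>1 \<xi>2 where "\<epsilon> > 0" "max_min_pair f1 f2 x \<epsilon> \<xi>1 \<xi>2" "norm (\<xi>1 - \<xi>2) > 0"
proof -
  from fail obtain \<epsilon> \<eta> where "\<epsilon> > 0" and eta: "\<eta> \<in> eps_subdiff \<epsilon> f2 x" "\<eta> \<notin> eps_subdiff \<epsilon> f1 x"
    by (auto simp: global_test_def)
  let ?S1 = "eps_subdiff \<epsilon> f1 x" and ?S2 = "eps_subdiff \<epsilon> f2 x"
  have ne: "?S1 \<noteq> {}"
    using eps_subdiff_nonempty[OF conv1 \<open>\<epsilon> > 0\<close>] .
  have inf: "(INF \<xi>\<in>?S1. norm (\<xi> - \<zeta>)) = infdist \<zeta> ?S1" for \<zeta>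
    using ne by (simp add: infdist_notempty dist_norm norm_minus_commute)
  have "compact ?S2"
    using convex_on_continuous[OF open_UNIV conv2] by (rule compact_eps_subdiff)
  moreover have "continuous_on ?S2 (\<lambda>\<zeta>. infdist \<zeta> ?S1)"
    by (intro continuous_intros)
  ultimately obtain \<xi>2 where xi2: "\<xi>2 \<in> ?S2" "\<And>\<zeta>. \<zeta> \<in> ?S2 \<Longrightarrow> infdist \<zeta> ?S1 \<le> infdist \<xi>2 ?S1"
    using continuous_attains_sup[of ?S2 "\<lambda>\<zeta>. infdist \<zeta> ?S1"] eta(1) by blast
  obtain \<xi>1 where xi1: "\<xi>1 \<in> ?S1" "infdist \<xi>2 ?S1 = dist \<xi>2 \<xi>1"
    using infdist_attains_inf[OF closed_eps_subdiff ne] by blast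
  have "infdist \<eta> ?S1 > 0"
    using in_closed_iff_infdist_zero[OF closed_eps_subdiff ne, of \<eta>] eta(2) infdist_nonneg[of \<eta> ?S1]
    by linarith
  then have "dist \<xi>2 \<xi>1 > 0"
    using xi2(2)[OF eta(1)] xi1(2) by linarith
  then have "norm (\<xi>1 - \<xi>2) > 0"
    by auto
  moreover have "max_min_pair f1 f2 x \<epsilon> \<xi>1 \<xi>2"
    unfolding max_min_pair_def inf
  proof
    show "is_arg_max (\<lambda>\<zeta>. infdist \<zeta> ?S1) (\<lambda>\<zeta>. \<zeta> \<in> ?S2) \<xi>2"
      using xi2 by (simp add: is_arg_max_linorder)
    show "is_arg_min (\<lambda>\<xi>. norm (\<xi> - \<xi>2)) (\<lambda>\<xi>. \<xi> \<in> ?S1) \<xi>1"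
      using xi1 infdist_le[of _ ?S1 \<xi>2]
      by (simp add: is_arg_min_linorder dist_norm norm_minus_commute)
  qed
  ultimately show thesis
    using that \<open>\<epsilon> > 0\<close> by blast
qed

section \<open>Finite termination of the hybrid method\<close>

lemma hybrid_step_decreases:
  fixes f1 f2 :: "'a::euclidean_space \<Rightarrow> real"
  assumes conv1: "convex_on UNIV f1"
    and step: "hybrid_step f1 f2 (Test x) (Local_Search y)"
  shows "f1 y - f2 y < f1 x - f2 x"
  using step
proof cases
  case (descent \<epsilon> \<xi>1 \<xi>2 d \<alpha>)
  obtain \<beta> where "\<beta> > 0" "f1 (x + \<beta> *\<^sub>R d) - f2 (x + \<beta> *\<^sub>R d) < f1 x - f2 x"
    using projection_residual_descends[OF conv1 \<open>\<epsilon> > 0\<close>, of \<xi>2 f2 x \<xi>1 d] descent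
    by (auto simp: max_min_pair_def is_arg_max_def)
  moreover have "f1 y - f2 y \<le> f1 (x + \<beta> *\<^sub>R d) - f2 (x + \<beta> *\<^sub>R d)"
    using descent \<open>\<beta> > 0\<close> by (auto simp: is_arg_min_linorder)
  ultimately show ?thesis
    by linarith
qed

text \<open>The values at the local minimizers found by an infinite execution would decrease strictly,
  while all of them are values at stationary points.\<close>

lemma no_infinite_execution:
  fixes f1 f2 :: "'a::euclidean_space \<Rightarrow> real"
  assumes conv1: "convex_on UNIV f1"
    and fin: "finite ((\<lambda>x. f1 x - f2 x) ` {x. stationary f1 f2 x})"
    and start: "\<sigma> (0::nat) = Local_Search x0"
    and steps: "\<And>m. hybrid_step f1 f2 (\<sigma> m) (\<sigma> (Suc m))"
  shows False
proof -
  let ?f = "\<lambda>x. f1 x - f2 x"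
  have from_search: "\<exists>x. \<sigma> (Suc m) = Test x \<and> local_minimizer ?f x \<and> ?f x \<le> ?f y"
    if "\<sigma> m = Local_Search y" for m y
    using steps[of m] unfolding that by (auto elim: hybrid_step.cases)
  have from_test: "\<exists>y. \<sigma> (Suc m) = Local_Search y" if "\<sigma> m = Test x" for m x
    using steps[of m] steps[of "Suc m"] unfolding that by (auto elim!: hybrid_step.cases)
  have "\<exists>y. \<sigma> (2 * k) = Local_Search y" for k
  proof (induction k)
    case (Suc k)
    then show ?case
      using from_search[of "2 * k"] from_test[of "Suc (2 * k)"] by auto
  qed (use start in simp)
  then obtain y where y: "\<And>k. \<sigma> (2 * k) = Local_Search (y k)"
    by metis
  obtain x where x: "\<And>k. \<sigma> (Suc (2 * k)) = Test (x k)" "\<And>k. local_minimizer ?f (x k)"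
    "\<And>k. ?f (x k) \<le> ?f (y k)"
    using from_search[OF y] by metis
  have "?f (x (Suc k)) < ?f (x k)" for k
  proof -
    have "hybrid_step f1 f2 (Test (x k)) (Local_Search (y (Suc k)))"
      using steps[of "Suc (2 * k)"] x(1)[of k] y[of "Suc k"] by simp
    from hybrid_step_decreases[OF conv1 this] x(3)[of "Suc k"] show ?thesis
      by linarith
  qed
  then have mono: "strict_mono (\<lambda>k. - ?f (x k))"
    unfolding strict_mono_Suc_iff by (simp only: neg_less_iff_less simp_thms)
  have "inj (\<lambda>k. ?f (x k))"
  proof (rule injI)
    fix i j assume "?f (x i) = ?f (x j)"
    then show "i = j"
      using strict_mono_eq[OF mono, of i j] by simp
  qed
  moreover have "range (\<lambda>k. ?f (x k)) \<subseteq> ?f ` {x. stationary f1 f2 x}"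
    using local_minimizer_imp_stationary[OF conv1 x(2)] by blast
  ultimately show False
    using fin finite_subset range_inj_infinite by blast
qed

text \<open>An execution cannot block: the local search may return the global minimizer \<open>xm\<close>, the max-min
  problem is solvable after a failed test, and the line search has a solution by the last
  hypothesis, because its direction is one of descent.\<close>

lemma hybrid_finds_global_minimizer:
  fixes f f1 f2 :: "'a::euclidean_space \<Rightarrow> real"
  assumes f_def: "f = (\<lambda>x. f1 x - f2 x)"
    and conv1: "convex_on UNIV f1" and conv2: "convex_on UNIV f2"
    and fin: "finite (f ` {x. stationary f1 f2 x})"
    and min: "\<And>y. f xm \<le> f y"
    and line: "\<And>x d \<beta>. \<beta> > 0 \<Longrightarrow> f (x + \<beta> *\<^sub>R d) < f x \<Longrightarrow>
      \<exists>\<alpha>>0. \<forall>a>0. f (x + \<alpha> *\<^sub>R d) \<le> f (x + a *\<^sub>R d)"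
  shows "hybrid_finds f1 f2 x0 (global_minimizer_on f UNIV)"
  unfolding hybrid_finds_def
proof (intro conjI allI impI)
  show "\<nexists>\<sigma>. \<sigma> (0::nat) = Local_Search x0 \<and> (\<forall>m. hybrid_step f1 f2 (\<sigma> m) (\<sigma> (Suc m)))"
    using no_infinite_execution[OF conv1] fin unfolding f_def by blast
next
  fix s
  assume s: "(hybrid_step f1 f2)\<^sup>*\<^sup>* (Local_Search x0) s \<and> (\<nexists>s'. hybrid_step f1 f2 s s')"
  show "\<exists>x. s = Returned x \<and> global_minimizer_on f UNIV x"
  proof (cases s)
    case (Local_Search y)
    have "local_minimizer f xm"
      using min by (simp add: local_minimizer_def)
    then have "hybrid_step f1 f2 s (Test xm)"
      unfolding Local_Search using min[of y]
      by (intro hybrid_step.local_search) (simp_all add: f_def)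
    with s show ?thesis
      by blast
  next
    case (Test x)
    have "\<exists>s'. hybrid_step f1 f2 s s'"
    proof (cases "global_test f1 f2 x")
      case True
      then show ?thesis
        unfolding Test using hybrid_step.stop by blast
    next
      case False
      then obtain \<epsilon> \<xi>1 \<xi>2 where pair: "\<epsilon> > 0" "max_min_pair f1 f2 x \<epsilon> \<xi>1 \<xi>2" "norm (\<xi>1 - \<xi>2) > 0"
        using failed_test_imp_max_min_pair[OF conv1 conv2] by blast
      define d where "d = - (\<xi>1 - \<xi>2)"
      obtain \<beta> where "\<beta> > 0" "f (x + \<beta> *\<^sub>R d) < f x"
        using projection_residual_descends[OF conv1 pair(1) _ _ pair(3) d_def, of f2 x] pair(2)
        unfolding f_def by (auto simp: max_min_pair_def is_arg_max_def)
      then obtain \<alpha> where "\<alpha> > 0" "\<forall>a>0. f (x + \<alpha> *\<^sub>R d) \<le> f (x + a *\<^sub>R d)"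
        using line by blast
      then have "is_arg_min
          (\<lambda>a. (f1 (x + a *\<^sub>R d) - f2 (x + a *\<^sub>R d)) - (f1 x - f2 x)) (\<lambda>a. a > 0) \<alpha>"
        by (simp add: is_arg_min_linorder f_def)
      from hybrid_step.descent[OF False pair d_def this] show ?thesis
        unfolding Test by blast
    qed
    with s show ?thesis
      by blast
  next
    case (Returned x)
    have "(hybrid_step f1 f2)\<^sup>*\<^sup>* (Local_Search x0) (Returned x)"
      using s Returned by simp
    then obtain s' where "hybrid_step f1 f2 s' (Returned x)"
      by (cases rule: rtranclp.cases) auto
    then have "global_test f1 f2 x"
      by (auto elim: hybrid_step.cases)
    then have "global_minimizer_on f UNIV x"
      using global_test_imp_global_minimizer[OF conv2]
      by (simp add: global_minimizer_on_def is_arg_min_linorder f_def)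
    with Returned show ?thesis
      by blast
  qed
qed

section \<open>Convexity of the two parts of the decomposition\<close>

lemma convex_on_quadratic_form:
  fixes M :: "real^'n^'n"
  assumes psd: "\<And>x. 0 \<le> (M *v x) \<bullet> x"
  shows "convex_on UNIV (\<lambda>x. (M *v x) \<bullet> x)"
proof (rule convex_onI)
  fix t :: real and x y :: "real^'n"
  assume "0 < t" "t < 1"
  \<comment> \<open>The defect of convexity of a quadratic form is a multiple of its value at the difference.\<close>
  have "(M *v ((1 - t) *\<^sub>R x + t *\<^sub>R y)) \<bullet> ((1 - t) *\<^sub>R x + t *\<^sub>R y) =
      (1 - t) * ((M *v x) \<bullet> x) + t * ((M *v y) \<bullet> y) - t * (1 - t) * ((M *v (x - y)) \<bullet> (x - y))"
    by (simp add: matrix_vector_right_distrib matrix_vector_mult_diff_distrib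
        matrix_vector_mult_scaleR inner_simps algebra_simps)
  also have "\<dots> \<le> (1 - t) * ((M *v x) \<bullet> x) + t * ((M *v y) \<bullet> y)"
    using psd[of "x - y"] \<open>0 < t\<close> \<open>t < 1\<close> by simp
  finally show "(M *v ((1 - t) *\<^sub>R x + t *\<^sub>R y)) \<bullet> ((1 - t) *\<^sub>R x + t *\<^sub>R y)
      \<le> (1 - t) * ((M *v x) \<bullet> x) + t * ((M *v y) \<bullet> y)" .
qed simp

lemma diag_shift_mult: "diag_shift A *v x =
    (\<chi> i. max ((\<Sum>k\<in>UNIV. \<bar>A $ i $ k\<bar>) - A $ i $ i) 0 * x $ i)"
  by (simp add: vec_eq_iff matrix_vector_mult_def diag_shift_def mult_delta_left)

lemma diag_shift_psd: "0 \<le> (diag_shift A *v x) \<bullet> x"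
  by (auto simp: diag_shift_mult inner_vec_def mult.assoc intro!: sum_nonneg)

text \<open>After the shift the matrix is diagonally dominant: every off-diagonal term is at least
  \<open>- \<bar>A $ i $ j\<bar> * ((x $ i)^2 + (x $ j)^2) / 2\<close>, and by symmetry of \<open>A\<close> the two squares may be
  charged to the diagonal entries \<open>i\<close> and \<open>j\<close>.\<close>

lemma shifted_matrix_psd:
  fixes A :: "real^'n^'n"
  assumes sym: "transpose A = A"
  shows "0 \<le> ((A + diag_shift A) *v x) \<bullet> x"
proof -
  have comm: "A $ i $ j = A $ j $ i" for i j
    using sym by (metis transpose_def vec_lambda_beta)
  define g where "g i j = A $ i $ j * x $ i * x $ j + \<bar>A $ i $ j\<bar> * (x $ i)\<^sup>2
      - (if j = i then A $ i $ i * (x $ i)\<^sup>2 else 0)" for i j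
  have g: "0 \<le> g i j + g j i" for i j
  proof (cases "j = i")
    case False
    have "g i j + g j i = 2 * A $ i $ j * x $ i * x $ j + \<bar>A $ i $ j\<bar> * ((x $ i)\<^sup>2 + (x $ j)\<^sup>2)"
      using False by (simp add: g_def comm[of j i] algebra_simps)
    also have "\<dots> = \<bar>A $ i $ j\<bar> * (x $ i + sgn (A $ i $ j) * x $ j)\<^sup>2"
      by (cases "A $ i $ j" "0::real" rule: linorder_cases)
        (simp_all add: power2_eq_square algebra_simps)
    finally show ?thesis
      by simp
  next
    case True
    have "g i i = \<bar>A $ i $ i\<bar> * (x $ i)\<^sup>2"
      by (simp add: g_def power2_eq_square)
    with True show ?thesis
      by simp
  qed
  have "(\<Sum>i\<in>UNIV. \<Sum>j\<in>UNIV. g i j) = (\<Sum>i\<in>UNIV. \<Sum>j\<in>UNIV. g j i)"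
    by (rule sum.swap)
  then have "2 * (\<Sum>i\<in>UNIV. \<Sum>j\<in>UNIV. g i j) = (\<Sum>i\<in>UNIV. \<Sum>j\<in>UNIV. g i j + g j i)"
    by (simp add: sum.distrib)
  also have "\<dots> \<ge> 0"
    by (intro sum_nonneg g)
  finally have nonneg: "0 \<le> (\<Sum>i\<in>UNIV. \<Sum>j\<in>UNIV. g i j)"
    by simp
  have row: "(\<Sum>j\<in>UNIV. g i j) = (A *v x) $ i * x $ i
      + ((\<Sum>k\<in>UNIV. \<bar>A $ i $ k\<bar>) - A $ i $ i) * (x $ i)\<^sup>2" for i
    by (simp add: g_def sum.distrib sum_subtractf matrix_vector_mult_def sum_distrib_left
        sum_distrib_right left_diff_distrib right_diff_distrib mult_ac)
  note nonneg
  also have "(\<Sum>i\<in>UNIV. \<Sum>j\<in>UNIV. g i j) = (\<Sum>i\<in>UNIV. (A *v x) $ i * x $ i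
      + ((\<Sum>k\<in>UNIV. \<bar>A $ i $ k\<bar>) - A $ i $ i) * (x $ i)\<^sup>2)"
    by (simp only: row)
  also have "(\<Sum>i\<in>UNIV. (A *v x) $ i * x $ i
      + ((\<Sum>k\<in>UNIV. \<bar>A $ i $ k\<bar>) - A $ i $ i) * (x $ i)\<^sup>2)
      \<le> (\<Sum>i\<in>UNIV. (A *v x) $ i * x $ i
      + max ((\<Sum>k\<in>UNIV. \<bar>A $ i $ k\<bar>) - A $ i $ i) 0 * (x $ i)\<^sup>2)"
    by (intro sum_mono add_left_mono mult_right_mono) auto
  also have "\<dots> = ((A + diag_shift A) *v x) \<bullet> x"
    by (simp add: matrix_vector_mult_add_rdistrib diag_shift_mult inner_vec_def sum.distrib
        power2_eq_square algebra_simps)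
  finally show ?thesis .
qed

text \<open>A pair \<open>(p, q)\<close> stands for the affine function \<open>\<lambda>x. p + q \<bullet> x\<close>.  As a maximum of finitely many
  such functions, the penalty is convex and eventually affine along every ray.\<close>

definition penalty_pieces :: "real^'n \<Rightarrow> real^'n \<Rightarrow> (real \<times> (real^'n)) set" where
  "penalty_pieces u v =
     {(0, 0)} \<union> range (\<lambda>i. (u $ i, - axis i 1)) \<union> range (\<lambda>i. (- (v $ i), axis i 1))"

lemma penalty_pieces: "finite (penalty_pieces u v)" "penalty_pieces u v \<noteq> {}"
  by (auto simp: penalty_pieces_def)

lemma box_penalty_eq_Max_affine:
  "box_penalty u v x = Max ((\<lambda>(p, q). p + q \<bullet> x) ` penalty_pieces u v)"
proof -
  have "(\<lambda>(p, q). p + q \<bullet> x) ` penalty_pieces u v =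
      {0} \<union> range (\<lambda>i. u $ i - x $ i) \<union> range (\<lambda>i. x $ i - v $ i)"
    by (simp add: penalty_pieces_def image_Un image_image inner_axis' algebra_simps)
  then show ?thesis
    by (simp only: box_penalty_def)
qed

lemma convex_on_Max_affine:
  fixes S :: "(real \<times> 'a::real_inner) set"
  assumes "finite S" "S \<noteq> {}"
  shows "convex_on UNIV (\<lambda>x. Max ((\<lambda>(p, q). p + q \<bullet> x) ` S))"
proof (rule convex_onI)
  fix t :: real and x y :: 'a
  assume t: "0 < t" "t < 1"
  let ?m = "\<lambda>x. Max ((\<lambda>(p, q). p + q \<bullet> x) ` S)"
  have le: "p + q \<bullet> z \<le> ?m z" if "(p, q) \<in> S" for p q z
    using that assms by (intro Max_ge) (auto intro!: image_eqI[of _ _ "(p, q)"])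
  have "p + q \<bullet> ((1 - t) *\<^sub>R x + t *\<^sub>R y) \<le> (1 - t) * ?m x + t * ?m y" if "(p, q) \<in> S" for p q
  proof -
    have "p + q \<bullet> ((1 - t) *\<^sub>R x + t *\<^sub>R y) = (1 - t) * (p + q \<bullet> x) + t * (p + q \<bullet> y)"
      by (simp add: inner_simps algebra_simps)
    also have "\<dots> \<le> (1 - t) * ?m x + t * ?m y"
      using t le[OF that] by (intro add_mono mult_left_mono) auto
    finally show ?thesis .
  qed
  then show "?m ((1 - t) *\<^sub>R x + t *\<^sub>R y) \<le> (1 - t) * ?m x + t * ?m y"
    using assms by (intro Max.boundedI) auto
qed simp

lemma convex_on_dc_f1:
  assumes "transpose A = A" "\<gamma> > 0"
  shows "convex_on UNIV (dc_f1 A b c u v \<gamma>)"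
proof -
  have quad: "convex_on UNIV (\<lambda>x. 1/2 * (((A + diag_shift A) *v x) \<bullet> x))"
    using shifted_matrix_psd[OF assms(1)] by (intro convex_on_cmul convex_on_quadratic_form) auto
  have lin: "convex_on UNIV (\<lambda>x. b \<bullet> x + c)"
    by (intro convex_onI) (auto simp: inner_simps algebra_simps)
  have pen: "convex_on UNIV (\<lambda>x. \<gamma> * box_penalty u v x)"
    unfolding box_penalty_eq_Max_affine using assms(2)
    by (intro convex_on_cmul convex_on_Max_affine penalty_pieces) auto
  show ?thesis
    using convex_on_add[OF convex_on_add[OF quad lin] pen]
    unfolding dc_f1_def[abs_def] quad_obj_def by (simp only: add.assoc)
qed

lemma convex_on_dc_f2: "convex_on UNIV (dc_f2 A)"
  unfolding dc_f2_def using diag_shift_psd by (intro convex_on_cmul convex_on_quadratic_form) auto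

lemma dc_f_eq_penalized_objective: "dc_f A b c u v \<gamma> x = quad_obj A b c x + \<gamma> * box_penalty u v x"
  by (simp add: dc_f_def dc_f1_def dc_f2_def quad_obj_def matrix_vector_mult_add_rdistrib
      inner_add_left algebra_simps)

section \<open>Solvability of the line search\<close>

text \<open>Any two affine functions are eventually ordered at infinity, so a finite family of them
  has an eventually dominating member.\<close>

lemma eventually_dominating_affine:
  fixes S :: "(real \<times> 'a::real_inner) set"
  assumes "finite S" "S \<noteq> {}"
  shows "\<exists>p k. \<forall>\<^sub>F a in at_top. Max ((\<lambda>(p, q). p + q \<bullet> (x + a *\<^sub>R d)) ` S) = p + k * a"
proof -
  define h where "h s a = fst s + snd s \<bullet> (x + a *\<^sub>R d)" for s and a :: real
  have affine: "h s a = (fst s + snd s \<bullet> x) + (snd s \<bullet> d) * a" for s a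
    by (simp add: h_def inner_simps algebra_simps)
  have compare: "(\<forall>\<^sub>F a in at_top. h s a \<le> h s' a) \<or> (\<forall>\<^sub>F a in at_top. h s' a \<le> h s a)" for s s'
  proof -
    have *: "\<forall>\<^sub>F a in at_top. p + k * a \<le> p' + k' * a" if "k < k'" for p p' k k' :: real
    proof -
      have "\<forall>\<^sub>F a in at_top. a \<ge> (p - p') / (k' - k)"
        by (rule eventually_ge_at_top)
      then show ?thesis
      proof eventually_elim
        case (elim a)
        then show ?case
          using that by (simp add: field_simps)
      qed
    qed
    show ?thesis
      unfolding affine
      using *[of "snd s \<bullet> d" "snd s' \<bullet> d"] *[of "snd s' \<bullet> d" "snd s \<bullet> d"]
      by (cases "snd s \<bullet> d" "snd s' \<bullet> d" rule: linorder_cases) (auto simp: linear)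
  qed
  have "\<exists>m\<in>S. \<forall>s\<in>S. \<forall>\<^sub>F a in at_top. h s a \<le> h m a"
    using assms
  proof (induction rule: finite_ne_induct)
    case (insert s S)
    then obtain m where m: "m \<in> S" "\<forall>s\<in>S. \<forall>\<^sub>F a in at_top. h s a \<le> h m a"
      by blast
    from compare[of s m] show ?case
    proof
      assume "\<forall>\<^sub>F a in at_top. h m a \<le> h s a"
      then have "\<forall>\<^sub>F a in at_top. h s' a \<le> h s a" if "s' \<in> S" for s'
        using bspec[OF m(2) that] by eventually_elim simp
      then show ?thesis
        by (intro bexI[of _ s]) auto
    qed (use m in auto)
  qed auto
  then obtain m where m: "m \<in> S" "\<forall>s\<in>S. \<forall>\<^sub>F a in at_top. h s a \<le> h m a"
    by blast
  then have "\<forall>\<^sub>F a in at_top. \<forall>s\<in>S. h s a \<le> h m a"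
    using assms(1) by (simp add: eventually_ball_finite)
  then have "\<forall>\<^sub>F a in at_top. Max ((\<lambda>(p, q). p + q \<bullet> (x + a *\<^sub>R d)) ` S)
      = (fst m + snd m \<bullet> x) + (snd m \<bullet> d) * a"
  proof eventually_elim
    case (elim a)
    have "Max ((\<lambda>s. h s a) ` S) = h m a"
      using elim m(1) assms(1) by (intro Max_eqI) auto
    then show ?case
      by (simp add: affine[symmetric]) (simp add: h_def case_prod_beta)
  qed
  then show ?thesis
    by blast
qed

text \<open>A quadratic polynomial bounded below is eventually nondecreasing, so all competitors beyond
  some point can be discarded and compactness applies to the rest.\<close>

lemma eventually_quadratic_attains_min:
  fixes \<phi> :: "real \<Rightarrow> real"
  assumes cont: "continuous_on UNIV \<phi>" and bdd: "\<And>a. B \<le> \<phi> a"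
    and quad: "\<forall>\<^sub>F a in at_top. \<phi> a = \<kappa> + \<beta> * a + \<alpha> * a\<^sup>2"
  obtains m where "m \<ge> 0" "\<And>a. a \<ge> 0 \<Longrightarrow> \<phi> m \<le> \<phi> a"
proof -
  let ?q = "\<lambda>a. \<kappa> + \<beta> * a + \<alpha> * a\<^sup>2"
  have no_bot: "\<not> filterlim ?q at_bot at_top"
  proof
    assume "filterlim ?q at_bot at_top"
    then have "\<forall>\<^sub>F a in at_top. ?q a < B"
      by (simp add: filterlim_at_bot_dense)
    with quad have "\<forall>\<^sub>F a::real in at_top. False"
    proof eventually_elim
      case (elim a)
      then show ?case
        using bdd[of a] by linarith
    qed
    then show False
      by simp
  qed
  have "\<not> \<alpha> < 0"
  proof
    assume "\<alpha> < 0"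
    then have "filterlim ?q at_bot at_top"
      by real_asymp
    with no_bot show False ..
  qed
  have "\<not> (\<alpha> = 0 \<and> \<beta> < 0)"
  proof
    assume "\<alpha> = 0 \<and> \<beta> < 0"
    then have "\<beta> < 0" "\<alpha> = 0"
      by auto
    then have "filterlim ?q at_bot at_top"
      by simp real_asymp
    with no_bot show False ..
  qed
  \<comment> \<open>If \<open>\<alpha> = 0\<close> then \<open>\<beta> \<ge> 0\<close>, and the quotient below is \<open>0\<close>.\<close>
  have nonneg: "0 \<le> 2 * \<alpha> * a + \<beta>" if "a \<ge> - \<beta> / (2 * \<alpha>)" for a
    using that \<open>\<not> \<alpha> < 0\<close> \<open>\<not> (\<alpha> = 0 \<and> \<beta> < 0)\<close>
    by (cases "\<alpha> = 0") (auto simp: field_simps)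
  obtain N where N: "\<And>a. a \<ge> N \<Longrightarrow> \<phi> a = ?q a"
    using quad by (auto simp: eventually_at_top_linorder)
  define T where "T = max (max N 0) (- \<beta> / (2 * \<alpha>))"
  have slope: "0 \<le> 2 * \<alpha> * T + \<beta>"
    by (rule nonneg) (simp add: T_def)
  have beyond: "\<phi> T \<le> \<phi> a" if "a \<ge> T" for a
  proof -
    have "0 \<le> \<alpha> * (a - T)"
      using that \<open>\<not> \<alpha> < 0\<close> by simp
    then have "0 \<le> (a - T) * (\<alpha> * (a - T) + (2 * \<alpha> * T + \<beta>))"
      using that by (intro mult_nonneg_nonneg[OF _ add_nonneg_nonneg[OF _ slope]]) auto
    also have "\<dots> = ?q a - ?q T"
      by (simp add: power2_eq_square algebra_simps)
    finally show ?thesis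
      using N[of a] N[of T] that by (simp add: T_def)
  qed
  have "T \<ge> 0"
    by (simp add: T_def)
  then obtain m where "m \<in> {0..T}" "\<And>a. a \<in> {0..T} \<Longrightarrow> \<phi> m \<le> \<phi> a"
    using continuous_attains_inf[of "{0..T}" \<phi>] continuous_on_subset[OF cont] by auto
  with that[of m] beyond \<open>T \<ge> 0\<close> show thesis
    by (metis atLeastAtMost_iff linear order_trans order_refl)
qed

lemma line_search_solvable:
  fixes A :: "real^'n^'n" and b u v x d :: "real^'n" and c \<gamma> \<beta> :: real
  defines "f \<equiv> dc_f A b c u v \<gamma>"
  assumes "transpose A = A" "\<gamma> > 0" and bdd: "bdd_below (range f)"
    and "\<beta> > 0" "f (x + \<beta> *\<^sub>R d) < f x"
  shows "\<exists>\<alpha>>0. \<forall>a>0. f (x + \<alpha> *\<^sub>R d) \<le> f (x + a *\<^sub>R d)"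
proof -
  obtain B where B: "\<And>y. B \<le> f y"
    using bdd by (auto simp: bdd_below_def)
  have "f = (\<lambda>y. dc_f1 A b c u v \<gamma> y - dc_f2 A y)"
    by (simp add: f_def dc_f_def fun_eq_iff)
  then have contf: "continuous_on UNIV f"
    using continuous_on_diff[OF convex_on_continuous[OF open_UNIV convex_on_dc_f1[OF assms(2,3)]]
        convex_on_continuous[OF open_UNIV convex_on_dc_f2]] by simp
  have "continuous_on UNIV (\<lambda>a::real. x + a *\<^sub>R d)"
    by (intro continuous_intros)
  then have cont: "continuous_on UNIV (\<lambda>a. f (x + a *\<^sub>R d))"
    using continuous_on_compose2[OF contf] by blast
  obtain p k where "\<forall>\<^sub>F a in at_top. box_penalty u v (x + a *\<^sub>R d) = p + k * a"
    using eventually_dominating_affine[OF penalty_pieces, of x d u v]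
    unfolding box_penalty_eq_Max_affine by blast
  then have "\<forall>\<^sub>F a in at_top. f (x + a *\<^sub>R d) = (quad_obj A b c x + \<gamma> * p)
      + (1/2 * ((A *v x) \<bullet> d) + 1/2 * ((A *v d) \<bullet> x) + b \<bullet> d + \<gamma> * k) * a
      + (1/2 * ((A *v d) \<bullet> d)) * a\<^sup>2"
    by eventually_elim
      (simp add: f_def dc_f_eq_penalized_objective quad_obj_def matrix_vector_right_distrib
        matrix_vector_mult_scaleR inner_simps algebra_simps power2_eq_square)
  then obtain m where m: "m \<ge> 0" "\<And>a. a \<ge> 0 \<Longrightarrow> f (x + m *\<^sub>R d) \<le> f (x + a *\<^sub>R d)"
    using eventually_quadratic_attains_min[OF cont B] by blast
  \<comment> \<open>The descent at \<open>\<beta>\<close> keeps the minimum over the closed ray away from its endpoint.\<close>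
  have "m \<noteq> 0"
    using m(2)[of \<beta>] assms(5,6) by auto
  with m show ?thesis
    by (intro exI[of _ m]) auto
qed

section \<open>The hybrid method for the box-constrained problem\<close>

theorem theorem3:
  fixes A :: "real^'n^'n" and b u v :: "real^'n" and c \<gamma> :: real
    and C :: "(real^'n) set" and x0 :: "real^'n"
  assumes "transpose A = A"
    and "\<And>i. u $ i \<le> v $ i"
    and "exact_penalty_parameter A b c u v \<gamma>"
    and "bdd_below (range (dc_f A b c u v \<gamma>))"
    and "C \<noteq> {}"
    and "{x. stationary (dc_f1 A b c u v \<gamma>) (dc_f2 A) x} \<subseteq> C"
    and "finite {t. \<exists>x\<in>C. t = dc_f A b c u v \<gamma> x}"
  shows "hybrid_finds (dc_f1 A b c u v \<gamma>) (dc_f2 A) x0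
           (global_minimizer_on (quad_obj A b c) (cbox u v))"
proof -
  let ?f1 = "dc_f1 A b c u v \<gamma>" and ?f2 = "dc_f2 A" and ?f = "dc_f A b c u v \<gamma>"
  have f: "(\<lambda>x. ?f1 x - ?f2 x) = ?f"
    by (simp add: dc_f_def fun_eq_iff)
  have "\<gamma> > 0" and exact: "global_minimizer_on ?f UNIV = global_minimizer_on (quad_obj A b c) (cbox u v)"
    using assms(3) by (auto simp: exact_penalty_parameter_def)
  have "u \<in> cbox u v"
    using assms(2) by (simp add: mem_box_cart)
  moreover have "continuous_on (cbox u v) (quad_obj A b c)"
    unfolding quad_obj_def[abs_def]
    by (intro continuous_intros linear_continuous_on_compose[OF _ matrix_vector_mul_linear])
  ultimately obtain xm where "xm \<in> cbox u v" "\<forall>y\<in>cbox u v. quad_obj A b c xm \<le> quad_obj A b c y"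
    using continuous_attains_inf[OF compact_cbox] by blast
  then have "global_minimizer_on ?f UNIV xm"
    unfolding exact by (simp add: global_minimizer_on_def is_arg_min_linorder)
  then have min: "?f xm \<le> ?f y" for y
    by (simp add: global_minimizer_on_def is_arg_min_linorder)
  have "?f ` {x. stationary ?f1 ?f2 x} \<subseteq> {t. \<exists>x\<in>C. t = ?f x}"
    using assms(6) by blast
  then have fin: "finite (?f ` {x. stationary ?f1 ?f2 x})"
    using assms(7) finite_subset by blast
  have "hybrid_finds ?f1 ?f2 x0 (global_minimizer_on ?f UNIV)"
    using hybrid_finds_global_minimizer[OF f[symmetric]
          convex_on_dc_f1[OF assms(1) \<open>\<gamma> > 0\<close>] convex_on_dc_f2 fin min
          line_search_solvable[OF assms(1) \<open>\<gamma> > 0\<close> assms(4)]] .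
  then show ?thesis
    unfolding exact .
qed

end
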